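(* For every integer $n\ge 2$ and every integer $m\ge 1$, $$s_{n,m}=-\sum_{i=2}^{n}c_{i,-(m+1)},$$ where $s_{n,m}=\sum_{k=1}^{n(n+1)/2}(a_{n,k})^m$ is the $m$-th power sum of the roots $a_{n,1},\dots,a_{n,n(n+1)/2}\in\mathbb{C}$ of the Yablonskii--Vorob'ev polynomial $Q_n(z)$, and $c_{i,-(m+1)}$ is the coefficient of $z^{-(m+1)}$ in the formal power expansion at $z=\infty$ of the solution of the second Painlevé equation $w_{zz}=2w^3+zw+\alpha$ at $\alpha=i$.
   Context: Yablonskii--Vorob'ev polynomials: $Q_0(z)=1$, $Q_1(z)=z$, and $Q_{n+1}Q_{n-1}=zQ_n^2-4\left(Q_nQ_n''-(Q_n')^2\right)$ for $n\ge 1$. Known facts taken as given: each $Q_n$ is a monic polynomial with integer coefficients, of degree $n(n+1)/2$, with only simple roots, and for $n\ge1$ the function $w(z;n)=\frac{d}{dz}\ln\frac{Q_{n-1}(z)}{Q_n(z)}$ is a rational solution of the second Painlevé equation $w_{zz}=2w^3+zw+\alpha$ with $\alpha=n$. Expansion at infinity: for each $\alpha$, the equation $w_{zz}=2w^3+zw+\alpha$ has a unique formal solution of the form $w(z;\alpha)=\frac{c_{\alpha,-1}}{z}+\sum_{l=1}^{\infty}c_{\alpha,-3l-1}z^{-3l-1}$. Explicitly, $c_{\alpha,-1}=-\alpha$ and, for $l\ge 0$, $c_{\alpha,-3(l+1)-1}=(3l+2)(3l+1)c_{\alpha,-3l-1}-2\sum_{m=0}^{l}\sum_{k=0}^{m}c_{\alpha,-3k-1}\,c_{\alpha,-3(m-k)-1}\,c_{\alpha,-3(l-m)-1}$.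 It is also written $w(z;\alpha)=\sum_{m=0}^{\infty}c_{\alpha,-(m+1)}z^{-(m+1)}$, where $c_{\alpha,-(m+1)}=0$ unless $m$ is divisible by $3$. *)

theory Defs
  imports Complex_Main "HOL-Computational_Algebra.Computational_Algebra"
begin

text \<open>
  Yablonskii--Vorob'ev polynomials. The recurrence
  \<open>Q(n+1) Q(n-1) = z Q(n)\<^sup>2 - 4 (Q(n) Q(n)'' - (Q(n)')\<^sup>2)\<close> is solved for \<open>Q(n+1)\<close>; since the
  \<open>Q(n)\<close> are (nonzero) polynomials, this \<open>div\<close> is an exact division.
\<close>

fun yv_poly :: "nat \<Rightarrow> complex poly" where
  "yv_poly 0 = 1"
| "yv_poly (Suc 0) = [:0, 1:]"
| "yv_poly (Suc (Suc n)) =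
     (let Q = yv_poly (Suc n) in
        ([:0, 1:] * Q ^ 2 - 4 * (Q * pderiv (pderiv Q) - (pderiv Q) ^ 2)) div yv_poly n)"

text \<open>The roots are enumerated with multiplicity, so there are \<open>degree = n (n + 1) / 2\<close> summands.\<close>

definition yv_power_sum :: "nat \<Rightarrow> nat \<Rightarrow> complex" where
  "yv_power_sum n m = (\<Sum>a\<in>#proots (yv_poly n). a ^ m)"

text \<open>
  A formal expansion at \<open>z = \<infinity>\<close> is a formal Laurent series in the variable \<open>t = 1/z\<close>:
  the coefficient of \<open>z\<^sup>-\<^sup>k\<close> is \<open>fls_nth W k\<close>, the function \<open>z\<close> itself is \<open>fls_X_inv\<close>,
  and \<open>d/dz = - t\<^sup>2 d/dt\<close>.
\<close>

definition fls_deriv_z :: "complex fls \<Rightarrow> complex fls" where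
  "fls_deriv_z W = - (fls_X ^ 2) * fls_deriv W"

text \<open>
  \<open>W\<close> has the form \<open>c(-1)/z + (\<Sum>l\<ge>1. c(-3l-1) z\<^sup>-\<^sup>3\<^sup>l\<^sup>-\<^sup>1)\<close> and solves
  \<open>w'' = 2 w\<^sup>3 + z w + \<alpha>\<close> formally.
\<close>

definition P2_formal_solution :: "complex \<Rightarrow> complex fls \<Rightarrow> bool" where
  "P2_formal_solution \<alpha> W \<longleftrightarrow>
     (\<forall>k. fls_nth W k \<noteq> 0 \<longrightarrow> (\<exists>l::nat. k = 3 * int l + 1)) \<and>
     fls_deriv_z (fls_deriv_z W) = 2 * W ^ 3 + fls_X_inv * W + fls_const \<alpha>"

definition P2_expansion :: "complex \<Rightarrow> complex fls" where
  "P2_expansion \<alpha> = (THE W. P2_formal_solution \<alpha> W)"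

text \<open>\<open>P2_coeff \<alpha> k\<close> is the coefficient of \<open>z\<^sup>k\<close>, i.e. of \<open>t\<close> to the power \<open>-k\<close>.\<close>

definition P2_coeff :: "complex \<Rightarrow> int \<Rightarrow> complex" where
  "P2_coeff \<alpha> k = fls_nth (P2_expansion \<alpha>) (- k)"

end

(*
  Since (ln Q)' = sum over roots of 1/(z - a), the coefficients of Q(n)'/Q(n) at infinity are the
  power sums, so those of w = (ln (Q(n-1)/Q(n)))' are s(n-1,m) - s(n,m); once w is identified with
  the formal solution of the second Painleve equation at alpha = n, the sum telescopes, and
  s(1,m) = 0.

  Exactness of the division defining Q(n+1) and the equation for w are proved together, by
  induction on n, for f = Q(n-1), g = Q(n), from Hirota's bilinear equations
    D^2 f.g = 0   and   D^3 f.g = z D f.g + n f g.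
  Modulo f these two and the derivative of the first give f' T(g) = 0 with
  T(g) = z g^2 - 4 (g g'' - g'^2). As f has only simple roots, f divides T(g), and the bilinear
  equations for (g, T(g)/f) follow from the Baecklund transformation
    w |-> -w - (2n+1)/(z + 2w^2 + 2w').
*)

theory Submission
  imports Defs "HOL-Computational_Algebra.Field_as_Ring"
begin

unbundle fps_syntax

section \<open>The derivation d/dz on Laurent series in t = 1/z\<close>

lemma fls_deriv_z_add: "fls_deriv_z (f + g) = fls_deriv_z f + fls_deriv_z g"
  by (simp add: fls_deriv_z_def algebra_simps)

lemma fls_deriv_z_diff: "fls_deriv_z (f - g) = fls_deriv_z f - fls_deriv_z g"
  by (simp add: fls_deriv_z_def algebra_simps)

lemma fls_deriv_z_minus: "fls_deriv_z (- f) = - fls_deriv_z f"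
  by (simp add: fls_deriv_z_def algebra_simps)

lemma fls_deriv_z_mult: "fls_deriv_z (f * g) = fls_deriv_z f * g + f * fls_deriv_z g"
  by (simp add: fls_deriv_z_def algebra_simps)

lemma fls_deriv_z_power2: "fls_deriv_z (f ^ 2) = 2 * f * fls_deriv_z f"
  by (simp add: power2_eq_square fls_deriv_z_mult)

lemma fls_deriv_z_const [simp]: "fls_deriv_z (fls_const c) = 0"
  by (simp add: fls_deriv_z_def)

lemma fls_deriv_z_0 [simp]: "fls_deriv_z 0 = 0"
  by (simp add: fls_deriv_z_def)

lemma fls_deriv_z_numeral [simp]: "fls_deriv_z (numeral k) = 0"
  by (simp add: fls_deriv_z_def)

lemma fls_deriv_z_X_inv [simp]: "fls_deriv_z fls_X_inv = 1"
proof -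
  have "(fls_X :: complex fls) * fls_X_inv = 1"
    by (metis fls_X_nonzero fls_inverse_X right_inverse)
  then have "(fls_X :: complex fls) ^ 2 * fls_X_inv ^ 2 = 1"
    by (metis power_mult_distrib power_one)
  then show ?thesis by (simp add: fls_deriv_z_def)
qed

lemmas fls_deriv_z_simps =
  fls_deriv_z_add fls_deriv_z_diff fls_deriv_z_minus fls_deriv_z_mult fls_deriv_z_power2

section \<open>Embedding of polynomials into the Laurent series at infinity\<close>

definition fls_of_poly :: "complex poly \<Rightarrow> complex fls" where
  "fls_of_poly p = poly (map_poly fls_const p) fls_X_inv"

lemma fls_of_poly_0 [simp]: "fls_of_poly 0 = 0"
  by (simp add: fls_of_poly_def)

lemma fls_of_poly_pCons [simp]:
  "fls_of_poly (pCons a p) = fls_const a + fls_X_inv * fls_of_poly p"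
  by (simp add: fls_of_poly_def map_poly_pCons)

lemma fls_of_poly_1 [simp]: "fls_of_poly 1 = 1"
  by (simp add: one_pCons)

lemma fls_of_poly_add: "fls_of_poly (p + q) = fls_of_poly p + fls_of_poly q"
proof (induction p arbitrary: q)
  case (pCons a p)
  show ?case
    by (cases q, simp add: pCons.IH flip: fls_plus_const) (simp add: algebra_simps)
qed simp

lemma fls_of_poly_smult: "fls_of_poly (smult c p) = fls_const c * fls_of_poly p"
  by (induction p) (auto simp: algebra_simps)

lemma fls_of_poly_minus: "fls_of_poly (- p) = - fls_of_poly p"
  using fls_of_poly_smult[of "- 1" p] by (simp add: fls_const_uminus)

lemma fls_of_poly_diff: "fls_of_poly (p - q) = fls_of_poly p - fls_of_poly q"
  using fls_of_poly_add[of p "- q"] by (simp add: fls_of_poly_minus)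

lemma fls_of_poly_mult: "fls_of_poly (p * q) = fls_of_poly p * fls_of_poly q"
  by (induction p) (auto simp: fls_of_poly_add fls_of_poly_smult algebra_simps)

lemma fls_of_poly_power: "fls_of_poly (p ^ k) = fls_of_poly p ^ k"
  by (induction k) (auto simp: fls_of_poly_mult)

lemma fls_of_poly_numeral [simp]: "fls_of_poly (numeral k) = numeral k"
  by (simp add: numeral_poly)

lemma fls_of_poly_of_nat [simp]: "fls_of_poly (of_nat k) = of_nat k"
  by (simp add: of_nat_poly fls_of_nat)

lemma fls_of_poly_pderiv: "fls_of_poly (pderiv p) = fls_deriv_z (fls_of_poly p)"
  by (induction p) (auto simp: pderiv_pCons fls_of_poly_add fls_deriv_z_simps algebra_simps)

lemmas fls_of_poly_hom =
  fls_of_poly_add fls_of_poly_diff fls_of_poly_mult fls_of_poly_power fls_of_poly_pderiv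

text \<open>Over the complex numbers p splits into linear factors, and z - a is nonzero as a series
  because its derivative is 1. Injectivity is what lets polynomial identities be checked in a field,
  where logarithmic derivatives exist.\<close>

lemma fls_of_poly_eq_0_iff [simp]: "fls_of_poly p = 0 \<longleftrightarrow> p = 0"
proof
  assume *: "fls_of_poly p = 0"
  show "p = 0"
  proof (rule ccontr)
    assume "p \<noteq> 0"
    have **: "fls_X_inv - fls_const a \<noteq> 0" for a :: complex
    proof
      assume "fls_X_inv - fls_const a = 0"
      then have "fls_deriv_z (fls_X_inv - fls_const a) = 0" by simp
      then show False by (simp add: fls_deriv_z_diff)
    qed
    have nz: "fls_of_poly (\<Prod>x\<in>#M. [:- x, 1:]) \<noteq> 0" for M :: "complex multiset"
      using **
      by (induction M) (auto simp: fls_of_poly_hom fls_of_poly_smult simp flip: fls_const_uminus)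
    show False
      using nz[of "proots p"] \<open>p \<noteq> 0\<close> *
      by (subst (asm) complex_poly_decompose_multiset[of p, symmetric])
         (auto simp: fls_of_poly_smult)
  qed
qed simp

section \<open>Hirota equations and the Baecklund transformation\<close>

text \<open>Logarithmic derivatives turn the two bilinear (Hirota) equations for \<open>(F, G)\<close> into an
  expression for \<open>(ln (F G))''\<close> and the second Painleve equation for \<open>w = (ln (F / G))'\<close>.\<close>

lemma bilinear2_iff:
  assumes "F \<noteq> 0" "G \<noteq> 0" and F: "fls_deriv_z F = u * F" and G: "fls_deriv_z G = v * G"
  shows "fls_deriv_z (fls_deriv_z F) * G - 2 * fls_deriv_z F * fls_deriv_z G
           + F * fls_deriv_z (fls_deriv_z G) = 0
         \<longleftrightarrow> fls_deriv_z u + fls_deriv_z v = - ((u - v) ^ 2)"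
proof -
  have "fls_deriv_z (fls_deriv_z F) * G - 2 * fls_deriv_z F * fls_deriv_z G
           + F * fls_deriv_z (fls_deriv_z G)
        = F * G * (fls_deriv_z u + fls_deriv_z v + (u - v) ^ 2)"
    by (simp add: F G fls_deriv_z_simps algebra_simps power2_eq_square)
  with assms show ?thesis by (simp add: add_eq_0_iff2)
qed

lemma bilinear3_iff:
  assumes "F \<noteq> 0" "G \<noteq> 0" and F: "fls_deriv_z F = u * F" and G: "fls_deriv_z G = v * G"
    and sum: "fls_deriv_z u + fls_deriv_z v = - ((u - v) ^ 2)"
  shows "fls_deriv_z (fls_deriv_z (fls_deriv_z F)) * G
           - 3 * fls_deriv_z (fls_deriv_z F) * fls_deriv_z G
           + 3 * fls_deriv_z F * fls_deriv_z (fls_deriv_z G)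
           - F * fls_deriv_z (fls_deriv_z (fls_deriv_z G))
         = fls_X_inv * (fls_deriv_z F * G - F * fls_deriv_z G) + c * (F * G)
         \<longleftrightarrow> fls_deriv_z (fls_deriv_z (u - v)) = 2 * (u - v) ^ 3 + fls_X_inv * (u - v) + c"
    (is "?L = ?R \<longleftrightarrow> ?l = ?r")
proof -
  have "?L - ?R = F * G * (?l + 3 * (u - v) * (fls_deriv_z u + fls_deriv_z v) + (u - v) ^ 3
                    - fls_X_inv * (u - v) - c)"
    by (simp add: F G fls_deriv_z_simps algebra_simps power2_eq_square power3_eq_cube)
  \<comment> \<open>By \<open>sum\<close> the middle term becomes -3 (u - v)^3; together with (u -
    v)^3 this is the cubic term of the Painleve equation.\<close>
  also have "\<dots> = F * G * (?l - ?r)"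
    unfolding sum by (simp add: algebra_simps power2_eq_square power3_eq_cube)
  finally show ?thesis using assms(1,2)
    by (metis eq_iff_diff_eq_0 mult_eq_0_iff)
qed

text \<open>The Painleve equation makes E' = 2 w E + (2a + 1) linear in E. Differentiating the
  constant (w1 + w) E and replacing 2a + 1 by -(w1 + w) E leaves a multiple of E, hence the
  first-order relation. Differentiating that relation once more raises the parameter by 1.\<close>

lemma P2_Baecklund:
  fixes w w1 E a :: "complex fls"
  assumes E: "E = fls_X_inv + 2 * w ^ 2 + 2 * fls_deriv_z w" and "E \<noteq> 0"
    and w1: "(w1 + w) * E = - (2 * a + 1)"
    and P2: "fls_deriv_z (fls_deriv_z w) = 2 * w ^ 3 + fls_X_inv * w + a"
    and a: "fls_deriv_z a = 0"
  shows "fls_deriv_z w1 = w1 ^ 2 - w ^ 2 - fls_deriv_z w"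
    and "fls_deriv_z (fls_deriv_z w1) = 2 * w1 ^ 3 + fls_X_inv * w1 + (a + 1)"
proof -
  have DE: "fls_deriv_z E = 2 * w * E + (2 * a + 1)"
    by (simp add: E fls_deriv_z_simps P2 algebra_simps power2_eq_square power3_eq_cube)
  have "fls_deriv_z ((w1 + w) * E) = 0"
    by (simp add: w1 fls_deriv_z_simps a flip: fls_const_1)
  then have "(fls_deriv_z w1 + fls_deriv_z w) * E + (w1 + w) * (2 * w * E + (2 * a + 1)) = 0"
    by (simp add: fls_deriv_z_simps DE)
  with w1 have "E * (fls_deriv_z w1 - (w1 ^ 2 - w ^ 2 - fls_deriv_z w)) = 0"
    by algebra
  with \<open>E \<noteq> 0\<close> show 1: "fls_deriv_z w1 = w1 ^ 2 - w ^ 2 - fls_deriv_z w"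
    by simp
  have "fls_deriv_z (fls_deriv_z w1) = fls_deriv_z (w1 ^ 2 - w ^ 2 - fls_deriv_z w)"
    by (simp only: 1)
  also have "\<dots> = 2 * w1 * fls_deriv_z w1 - 2 * w * fls_deriv_z w - fls_deriv_z (fls_deriv_z w)"
    by (simp add: fls_deriv_z_simps)
  also have "\<dots> = 2 * w1 ^ 3 + fls_X_inv * w1 + (a + 1)"
    using w1 unfolding E P2 1 by algebra
  finally show "fls_deriv_z (fls_deriv_z w1) = 2 * w1 ^ 3 + fls_X_inv * w1 + (a + 1)" .
qed

section \<open>The bilinear equations for polynomials\<close>

definition toda :: "complex poly \<Rightarrow> complex poly" where
  "toda g = [:0, 1:] * g ^ 2 - 4 * (g * pderiv (pderiv g) - (pderiv g) ^ 2)"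

text \<open>Hirota's D^2 f.g = 0; \<open>bilinear3\<close> is the D^3 equation. Both are stated for
  polynomials, free of denominators, since the divisibility argument works modulo f.\<close>

definition bilinear2 :: "complex poly \<Rightarrow> complex poly \<Rightarrow> bool" where
  "bilinear2 f g \<longleftrightarrow>
     pderiv (pderiv f) * g - 2 * pderiv f * pderiv g + f * pderiv (pderiv g) = 0"

definition bilinear3 :: "nat \<Rightarrow> complex poly \<Rightarrow> complex poly \<Rightarrow> bool" where
  "bilinear3 n f g \<longleftrightarrow>
     pderiv (pderiv (pderiv f)) * g - 3 * pderiv (pderiv f) * pderiv g
       + 3 * pderiv f * pderiv (pderiv g) - f * pderiv (pderiv (pderiv g))
     = [:0, 1:] * (pderiv f * g - f * pderiv g) + of_nat n * (f * g)"

definition log_deriv :: "complex poly \<Rightarrow> complex fls" where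
  "log_deriv p = fls_deriv_z (fls_of_poly p) / fls_of_poly p"

lemma fls_deriv_z_fls_of_poly:
  "p \<noteq> 0 \<Longrightarrow> fls_deriv_z (fls_of_poly p) = log_deriv p * fls_of_poly p"
  by (simp add: log_deriv_def)

lemma fls_of_poly_eq_iff [simp]: "fls_of_poly p = fls_of_poly q \<longleftrightarrow> p = q"
  using fls_of_poly_eq_0_iff[of "p - q"] by (simp add: fls_of_poly_diff)

lemma bilinear2_log_deriv:
  assumes "f \<noteq> 0" "g \<noteq> 0"
  shows "bilinear2 f g \<longleftrightarrow>
    fls_deriv_z (log_deriv f) + fls_deriv_z (log_deriv g) = - ((log_deriv f - log_deriv g) ^ 2)"
proof -
  have "bilinear2 f g \<longleftrightarrow>
      fls_of_poly (pderiv (pderiv f) * g - 2 * pderiv f * pderiv g + f * pderiv (pderiv g)) = 0"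
    by (simp only: bilinear2_def fls_of_poly_eq_0_iff)
  also have "\<dots> \<longleftrightarrow>
      fls_deriv_z (log_deriv f) + fls_deriv_z (log_deriv g) = - ((log_deriv f - log_deriv g) ^ 2)"
    using bilinear2_iff[of "fls_of_poly f" "fls_of_poly g" "log_deriv f" "log_deriv g"] assms
    by (simp only: fls_of_poly_hom fls_of_poly_numeral fls_deriv_z_fls_of_poly
        fls_of_poly_eq_0_iff not_False_eq_True simp_thms)
  finally show ?thesis .
qed

lemma bilinear3_log_deriv:
  assumes "f \<noteq> 0" "g \<noteq> 0" "bilinear2 f g"
  defines "w \<equiv> log_deriv f - log_deriv g"
  shows "bilinear3 n f g \<longleftrightarrow>
    fls_deriv_z (fls_deriv_z w) = 2 * w ^ 3 + fls_X_inv * w + of_nat n"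
proof -
  have X: "fls_of_poly [:0, 1:] = fls_X_inv" by simp
  have "bilinear3 n f g \<longleftrightarrow>
      fls_of_poly (pderiv (pderiv (pderiv f)) * g - 3 * pderiv (pderiv f) * pderiv g
       + 3 * pderiv f * pderiv (pderiv g) - f * pderiv (pderiv (pderiv g)))
     = fls_of_poly ([:0, 1:] * (pderiv f * g - f * pderiv g) + of_nat n * (f * g))"
    by (simp only: bilinear3_def fls_of_poly_eq_iff)
  also have "\<dots> \<longleftrightarrow> fls_deriv_z (fls_deriv_z w) = 2 * w ^ 3 + fls_X_inv * w + of_nat n"
    unfolding w_def
    using bilinear3_iff[of "fls_of_poly f" "fls_of_poly g" "log_deriv f" "log_deriv g" "of_nat n"]
      assms(1,2,3) bilinear2_log_deriv[OF assms(1,2)]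
    by (simp only: fls_of_poly_hom fls_of_poly_numeral fls_of_poly_of_nat X fls_deriv_z_fls_of_poly
        fls_of_poly_eq_0_iff not_False_eq_True simp_thms)
  finally show ?thesis .
qed

section \<open>Divisibility, simple roots and the passage to the next polynomial\<close>

lemma toda_nonzero:
  assumes "g \<noteq> 0"
  shows "toda g \<noteq> 0"
proof
  assume "toda g = 0"
  then have eq: "[:0, 1:] * g ^ 2 = 4 * (g * pderiv (pderiv g) - (pderiv g) ^ 2)"
    by (simp add: toda_def)
  \<comment> \<open>The factor z raises the degree of this term above that of everything subtracted
    from it.\<close>
  have "degree ([:0, 1:] * g ^ 2) = 2 * degree g + 1"
    using assms by (subst degree_mult_eq) (auto simp: degree_power_eq)
  moreover have "degree (4 * (g * pderiv (pderiv g) - (pderiv g) ^ 2)) \<le> 2 * degree g"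
  proof -
    have "degree (g * pderiv (pderiv g)) \<le> 2 * degree g"
      using degree_mult_le[of g "pderiv (pderiv g)"] by (simp add: degree_pderiv)
    moreover have "degree ((pderiv g) ^ 2) \<le> 2 * degree g"
      using degree_power_le[of "pderiv g" 2] by (simp add: degree_pderiv)
    ultimately have "degree (g * pderiv (pderiv g) - (pderiv g) ^ 2) \<le> 2 * degree g"
      by (rule degree_diff_le)
    then show ?thesis
      using degree_mult_le[of 4 "g * pderiv (pderiv g) - (pderiv g) ^ 2"] by simp
  qed
  ultimately show False unfolding eq by simp
qed

text \<open>A root of a common divisor would be a multiple root of f; a complex polynomial without
  roots is constant.\<close>

lemma coprime_pderiv_if_rsquarefree:
  fixes f :: "complex poly"
  assumes "rsquarefree f"
  shows "coprime f (pderiv f)"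
proof (rule coprimeI)
  fix d assume d: "d dvd f" "d dvd pderiv f"
  have "\<not> poly d a = 0" for a
    using d assms unfolding rsquarefree_roots by (metis dvd_trans poly_eq_0_iff_dvd)
  then have "constant (poly d)"
    using fundamental_theorem_of_algebra by blast
  moreover have "d \<noteq> 0"
    using d(1) assms unfolding rsquarefree_def by auto
  ultimately show "is_unit d"
    by (simp add: constant_degree is_unit_iff_degree)
qed

lemma bilinear_imp_dvd_toda:
  assumes "bilinear2 f g" "bilinear3 n f g" "rsquarefree f"
  shows "f dvd toda g"
proof -
  have 1: "pderiv (pderiv f) * g - 2 * pderiv f * pderiv g + f * pderiv (pderiv g) = 0"
    using assms(1) by (simp add: bilinear2_def)
  then have "pderiv (pderiv (pderiv f) * g - 2 * pderiv f * pderiv g + f * pderiv (pderiv g)) = 0"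
    by simp
  then have 2: "pderiv (pderiv (pderiv f)) * g - pderiv (pderiv f) * pderiv g
      - pderiv f * pderiv (pderiv g) + f * pderiv (pderiv (pderiv g)) = 0"
    by (simp add: pderiv_mult pderiv_add pderiv_diff algebra_simps)
  have 3: "pderiv (pderiv (pderiv f)) * g - 3 * pderiv (pderiv f) * pderiv g
       + 3 * pderiv f * pderiv (pderiv g) - f * pderiv (pderiv (pderiv g))
     = [:0, 1:] * (pderiv f * g - f * pderiv g) + of_nat n * (f * g)"
    using assms(2) by (simp add: bilinear3_def)
  \<comment> \<open>Subtracting 2 from 3 eliminates f'''. After multiplication by g, the product f''
    g is replaced through 1, so that only multiples of f' and of f remain.\<close>
  have "pderiv f * toda g =
      f * (g * ([:0, 1:] * pderiv g - of_nat n * g - 2 * pderiv (pderiv (pderiv g)))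
           + 2 * pderiv g * pderiv (pderiv g))"
    using 1 2 3 unfolding toda_def by algebra
  then have "f dvd pderiv f * toda g" by simp
  with coprime_pderiv_if_rsquarefree[OF assms(3)] show ?thesis
    by (simp add: coprime_dvd_mult_right_iff)
qed

text \<open>At a multiple root of g, of order k + 1, the terms with g and g' vanish to order at
  least k, hence so does f g''. But f does not vanish there and g'' has order only k - 1.\<close>

lemma bilinear2_imp_rsquarefree:
  assumes "bilinear2 f g" "g \<noteq> 0" and coprime: "\<And>a. \<not> (poly f a = 0 \<and> poly g a = 0)"
  shows "rsquarefree g"
  unfolding rsquarefree_roots
proof (intro allI notI, elim conjE)
  fix a assume a: "poly g a = 0" "poly (pderiv g) a = 0"
  have g': "pderiv g \<noteq> 0"
  proof
    assume "pderiv g = 0"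
    then have "degree g = 0" by (simp add: pderiv_eq_0_iff)
    with a \<open>g \<noteq> 0\<close> show False by (metis poly_const_conv pCons_0_0 degree_eq_zeroE)
  qed
  have g'': "pderiv (pderiv g) \<noteq> 0"
  proof
    assume "pderiv (pderiv g) = 0"
    then have "degree (pderiv g) = 0" by (simp add: pderiv_eq_0_iff)
    with a g' show False by (metis poly_const_conv pCons_0_0 degree_eq_zeroE)
  qed
  define k where "k = order a (pderiv g)"
  have g: "order a g = Suc k" and k: "k = Suc (order a (pderiv (pderiv g)))"
    unfolding k_def using a g' \<open>g \<noteq> 0\<close> by (auto intro: order_pderiv)
  have "f * pderiv (pderiv g) = 2 * pderiv f * pderiv g - pderiv (pderiv f) * g"
    using assms(1) unfolding bilinear2_def by algebra
  moreover have "[:- a, 1:] ^ k dvd pderiv g"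
    unfolding k_def by (rule order_1)
  moreover have "[:- a, 1:] ^ k dvd g"
    using order_1[of a g] unfolding g by (metis dvd_trans le_imp_power_dvd le_SucI order_refl)
  ultimately have "[:- a, 1:] ^ k dvd f * pderiv (pderiv g)"
    by simp
  moreover have f: "poly f a \<noteq> 0" using coprime a by blast
  ultimately have "k \<le> order a (f * pderiv (pderiv g))"
    using g'' by (auto simp: order_divides)
  also have "\<dots> = order a (pderiv (pderiv g))"
    using f g'' by (subst order_mult) (auto simp: order_0I)
  finally show False using k by simp
qed

lemma bilinear_step:
  assumes f: "f \<noteq> 0" and g: "g \<noteq> 0" and h: "h * f = toda g"
    and A: "bilinear2 f g" and B: "bilinear3 n f g"
  shows "bilinear2 g h" "bilinear3 (Suc n) g h"
proof -
  have "h \<noteq> 0" using h toda_nonzero[OF g] by auto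
  define u v x w where "u = log_deriv f" and "v = log_deriv g" and "x = log_deriv h"
    and "w = log_deriv f - log_deriv g"
  define F G H where "F = fls_of_poly f" and "G = fls_of_poly g" and "H = fls_of_poly h"
  have nz: "F \<noteq> 0" "G \<noteq> 0" "H \<noteq> 0"
    using f g \<open>h \<noteq> 0\<close> by (auto simp: F_def G_def H_def)
  have DF: "fls_deriv_z F = u * F" and DG: "fls_deriv_z G = v * G" and DH: "fls_deriv_z H = x * H"
    using f g \<open>h \<noteq> 0\<close>
    by (simp_all add: F_def G_def H_def u_def v_def x_def fls_deriv_z_fls_of_poly)
  have w: "w = u - v" by (simp add: w_def u_def v_def)
  have sum: "fls_deriv_z u + fls_deriv_z v = - (w ^ 2)"
    using A bilinear2_log_deriv[OF f g] by (simp add: u_def v_def w_def)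
  have P2: "fls_deriv_z (fls_deriv_z w) = 2 * w ^ 3 + fls_X_inv * w + of_nat n"
    using B bilinear3_log_deriv[OF f g A] by (simp add: w_def)
  define E where "E = fls_X_inv + 2 * w ^ 2 + 2 * fls_deriv_z w"
  \<comment> \<open>The denominator of the Baecklund transformation is z - 4 (ln g)'', so
    \<open>toda g\<close> is g^2 times it.\<close>
  have E: "E = fls_X_inv - 4 * fls_deriv_z v"
    using sum by (simp add: E_def w fls_deriv_z_diff algebra_simps eq_neg_iff_add_eq_0) algebra
  have "H * F = fls_of_poly (toda g)"
    unfolding h[symmetric] by (simp add: H_def F_def fls_of_poly_mult)
  also have "\<dots> = fls_X_inv * G ^ 2 - 4 * (G * fls_deriv_z (fls_deriv_z G) - (fls_deriv_z G) ^ 2)"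
    by (simp add: toda_def G_def fls_of_poly_hom)
  also have "\<dots> = G ^ 2 * E"
    by (simp add: E DG fls_deriv_z_simps algebra_simps power2_eq_square)
  finally have HF: "H * F = G ^ 2 * E" .
  with nz have "E \<noteq> 0" by auto
  \<comment> \<open>Logarithmic differentiation of h f = g^2 E gives x + u = 2 v + E'/E. With the
    equation for E', the new function v - x is then the Baecklund transform of w.\<close>
  have "fls_deriv_z (H * F) = fls_deriv_z (G ^ 2 * E)"
    by (simp only: HF)
  then have "(x + u) * (H * F) = G ^ 2 * (2 * v * E + fls_deriv_z E)"
    by (simp add: fls_deriv_z_simps DF DG DH algebra_simps power2_eq_square)
  then have "G ^ 2 * ((x + u) * E) = G ^ 2 * (2 * v * E + fls_deriv_z E)"
    unfolding HF by (simp add: mult_ac)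
  then have "(x + u) * E = 2 * v * E + fls_deriv_z E"
    using nz by simp
  moreover have DE: "fls_deriv_z E = 2 * w * E + (2 * of_nat n + 1)"
    by (simp add: E_def fls_deriv_z_simps P2 fls_of_nat algebra_simps power2_eq_square power3_eq_cube)
  ultimately have w1: "(v - x + w) * E = - (2 * of_nat n + 1)"
    unfolding w by algebra
  have "fls_deriv_z (of_nat n) = 0" by (simp add: fls_of_nat)
  note BT = P2_Baecklund[OF E_def \<open>E \<noteq> 0\<close> w1 P2 this]
  \<comment> \<open>Eliminating u' between the first-order relation and \<open>sum\<close> leaves
    the second-order bilinear equation for (g, h).\<close>
  have "fls_deriv_z v + fls_deriv_z x = - ((v - x) ^ 2)"
    using BT(1) sum unfolding w fls_deriv_z_diff by algebra
  then show A': "bilinear2 g h"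
    using bilinear2_log_deriv[OF g \<open>h \<noteq> 0\<close>] by (simp add: v_def x_def)
  show "bilinear3 (Suc n) g h"
    using BT(2) bilinear3_log_deriv[OF g \<open>h \<noteq> 0\<close> A', of "Suc n"]
    by (simp add: v_def x_def add.commute)
qed

section \<open>The bilinear equations for the Yablonskii--Vorob'ev polynomials\<close>

lemma yv_poly_Suc_Suc: "yv_poly (Suc (Suc n)) = toda (yv_poly (Suc n)) div yv_poly n"
  by (simp add: toda_def Let_def)

text \<open>The invariant carries what the next step consumes: simple roots of Q(n) make the
  division by Q(n) exact, and the absence of common roots passes simple roots on to Q(n+1).\<close>

lemma yv_poly_bilinear:
  "bilinear2 (yv_poly n) (yv_poly (Suc n)) \<and> bilinear3 (Suc n) (yv_poly n) (yv_poly (Suc n)) \<and>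
   rsquarefree (yv_poly n) \<and> yv_poly (Suc n) \<noteq> 0 \<and>
   (\<forall>a. \<not> (poly (yv_poly n) a = 0 \<and> poly (yv_poly (Suc n)) a = 0))"
proof (induction n)
  case 0
  show ?case
    by (simp add: bilinear2_def bilinear3_def rsquarefree_roots pderiv_pCons)
next
  case (Suc n)
  define f g h where "f = yv_poly n" and "g = yv_poly (Suc n)" and "h = yv_poly (Suc (Suc n))"
  have A: "bilinear2 f g" and B: "bilinear3 (Suc n) f g" and f: "rsquarefree f" and g: "g \<noteq> 0"
    and cop: "\<And>a. \<not> (poly f a = 0 \<and> poly g a = 0)"
    using Suc.IH by (auto simp: f_def g_def)
  have "f \<noteq> 0" using f by (simp add: rsquarefree_def)
  have h: "h * f = toda g"
    using bilinear_imp_dvd_toda[OF A B f] unfolding h_def f_def g_def yv_poly_Suc_Suc by simp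
  have sqf: "rsquarefree g" using bilinear2_imp_rsquarefree[OF A g cop] .
  \<comment> \<open>At a root of g, \<open>toda g\<close> reduces to 4 g'^2; a common root with h
    would therefore be a multiple root of g.\<close>
  have "\<not> (poly g a = 0 \<and> poly h a = 0)" for a
  proof
    assume a: "poly g a = 0 \<and> poly h a = 0"
    then have "poly (toda g) a = 0" by (simp flip: h)
    with a have "poly (pderiv g) a = 0" by (simp add: toda_def)
    with a sqf show False by (simp add: rsquarefree_roots)
  qed
  moreover have "h \<noteq> 0" using h toda_nonzero[OF g] by auto
  ultimately show ?case
    using bilinear_step[OF \<open>f \<noteq> 0\<close> g h A B] sqf unfolding f_def g_def h_def by blast
qed

section \<open>Power sums of roots as coefficients at infinity\<close>

lemma fls_X_inv_minus_const_times_geometric: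
  fixes a :: complex
  defines "s \<equiv> Abs_fls (\<lambda>k. if k \<ge> 1 then a ^ nat (k - 1) else 0)"
  shows "s $$ k = (if k \<ge> 1 then a ^ nat (k - 1) else 0)"
    and "(fls_X_inv - fls_const a) * s = 1"
proof -
  show nth: "s $$ k = (if k \<ge> 1 then a ^ nat (k - 1) else 0)" for k
    unfolding s_def by (rule nth_Abs_fls_lower_bound[of 1]) auto
  show "(fls_X_inv - fls_const a) * s = 1"
  proof (rule fls_eqI)
    fix k :: int
    have "a ^ nat k = a * a ^ nat (k - 1)" if "k \<ge> 1"
      using that by (metis Suc_nat_eq_nat_zadd1 add.commute diff_add_cancel diff_ge_0_iff_ge power_Suc)
    then show "((fls_X_inv - fls_const a) * s) $$ k = 1 $$ k"
      by (auto simp: left_diff_distrib fls_X_inv_times_conv_shift nth)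
  qed
qed

text \<open>Each root a contributes the geometric series 1/(z - a) = t + a t^2 + ..., and the
  leading coefficient of p cancels. The shift by one is why the m-th power sum sits at
  t^(m+1).\<close>

lemma log_deriv_nth:
  assumes "p \<noteq> 0"
  shows "log_deriv p $$ k = (if k \<ge> 1 then (\<Sum>a\<in>#proots p. a ^ nat (k - 1)) else 0)"
proof -
  define s where "s a = Abs_fls (\<lambda>k. if k \<ge> 1 then a ^ nat (k - 1) else (0 :: complex))" for a
  note geom = fls_X_inv_minus_const_times_geometric[folded s_def]
  have lin: "fls_of_poly [:- a, 1:] = fls_X_inv - fls_const a" for a
    by (simp flip: fls_const_uminus)
  have prod: "fls_deriv_z (fls_of_poly (\<Prod>a\<in>#M. [:- a, 1:]))
      = (\<Sum>a\<in>#M. s a) * fls_of_poly (\<Prod>a\<in>#M. [:- a, 1:])" for M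
  proof (induction M)
    case (add a M)
    have "fls_deriv_z (fls_of_poly [:- a, 1:]) = s a * fls_of_poly [:- a, 1:]"
      unfolding lin using geom(2)[of a] by (simp add: fls_deriv_z_diff mult.commute)
    with add show ?case
      by (simp only: image_mset_add_mset prod_mset.add_mset sum_mset.add_mset
          fls_of_poly_mult fls_deriv_z_mult) (simp only: algebra_simps)
  qed (simp flip: fls_const_1)
  have "fls_deriv_z (fls_of_poly p) = (\<Sum>a\<in>#proots p. s a) * fls_of_poly p"
    by (subst (1 3) complex_poly_decompose_multiset[of p, symmetric])
       (simp only: fls_of_poly_smult fls_deriv_z_mult fls_deriv_z_const prod mult_zero_left
         add_0_left mult_ac)
  then have "log_deriv p = (\<Sum>a\<in>#proots p. s a)"
    using assms by (simp add: log_deriv_def)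
  moreover have "(\<Sum>a\<in>#M. s a) $$ k = (\<Sum>a\<in>#M. s a $$ k)" for M
    by (induction M) auto
  ultimately show ?thesis
    by (simp add: geom(1))
qed

section \<open>Uniqueness and exponents of the formal Painleve solution\<close>

lemma fls_deriv_z_nth: "fls_deriv_z W $$ k = - (of_int (k - 1) * W $$ (k - 1))"
  by (simp add: fls_deriv_z_def fls_X_power_times_conv_shift)

lemma fls_subdegree_ge0_iff: "fls_subdegree f \<ge> 0 \<longleftrightarrow> (\<forall>k<0. f $$ k = 0)"
  by (auto intro: fls_subdegree_ge0I)

lemma fls_subdegree_add_ge0:
  "fls_subdegree f \<ge> 0 \<Longrightarrow> fls_subdegree g \<ge> 0 \<Longrightarrow> fls_subdegree (f + g) \<ge> 0"
  by (simp add: fls_subdegree_ge0_iff)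

lemma fls_subdegree_mult_ge0:
  fixes f g :: "'a :: comm_semiring_1 fls"
  shows "fls_subdegree f \<ge> 0 \<Longrightarrow> fls_subdegree g \<ge> 0 \<Longrightarrow> fls_subdegree (f * g) \<ge> 0"
  unfolding fls_subdegree_ge0_iff[of "f * g"] by (auto intro!: fls_times_nth_eq0)

text \<open>The difference d satisfies d'' = (z + S) d, where S has no negative powers of t. If d
  starts at t^s, then z d starts at t^(s-1), while d'' and S d have no term there.\<close>

lemma P2_formal_solution_unique:
  assumes "fls_subdegree V \<ge> 0" "fls_subdegree W \<ge> 0"
    and V: "fls_deriv_z (fls_deriv_z V) = 2 * V ^ 3 + fls_X_inv * V + fls_const \<alpha>"
    and W: "fls_deriv_z (fls_deriv_z W) = 2 * W ^ 3 + fls_X_inv * W + fls_const \<alpha>"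
  shows "V = W"
proof (rule ccontr)
  define d where "d = V - W"
  define S where "S = 2 * (V * V + V * W + W * W)"
  define s where "s = fls_subdegree d"
  assume "V \<noteq> W"
  then have "d \<noteq> 0" by (simp add: d_def)
  then have "d $$ s \<noteq> 0" unfolding s_def by (rule nth_fls_subdegree_nonzero)
  have "fls_subdegree S \<ge> 0"
    unfolding S_def using assms(1,2)
    by (intro fls_subdegree_mult_ge0 fls_subdegree_add_ge0) auto
  have "fls_deriv_z (fls_deriv_z d) = d * S + fls_X_inv * d"
    by (simp add: d_def S_def fls_deriv_z_diff V W algebra_simps power3_eq_cube)
  then have "fls_deriv_z (fls_deriv_z d) $$ (s - 1) = (d * S) $$ (s - 1) + (fls_X_inv * d) $$ (s - 1)"
    by simp
  moreover have "(d * S) $$ (s - 1) = 0"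
    using \<open>fls_subdegree S \<ge> 0\<close> by (intro fls_times_nth_eq0) (simp add: s_def)
  moreover have "fls_deriv_z (fls_deriv_z d) $$ (s - 1) = 0"
    by (simp add: fls_deriv_z_nth s_def)
  ultimately show False
    using \<open>d $$ s \<noteq> 0\<close> by (simp add: fls_X_inv_times_conv_shift)
qed

lemma fls_mult_support_mod:
  fixes f g :: "'a :: comm_ring_1 fls"
  assumes "\<And>k. f $$ k \<noteq> 0 \<Longrightarrow> q dvd k - a" "\<And>k. g $$ k \<noteq> 0 \<Longrightarrow> q dvd k - b"
    and "(f * g) $$ k \<noteq> 0"
  shows "q dvd k - (a + b)"
proof -
  from assms(3) obtain i where "f $$ i * g $$ (k - i) \<noteq> 0"
    unfolding fls_times_nth(2) by (meson sum.not_neutral_contains_not_neutral)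
  then have "f $$ i \<noteq> 0" "g $$ (k - i) \<noteq> 0" by auto
  then have "q dvd (i - a) + (k - i - b)"
    using assms(1,2) by (intro dvd_add)
  then show ?thesis by (simp add: algebra_simps)
qed

text \<open>Split \<open>W = A + B\<close> with \<open>A\<close> collecting the exponents \<open>\<equiv> 1 (mod 3)\<close>. The cube of \<open>A\<close> has only
  exponents divisible by \<open>3\<close>, so the lowest term of \<open>t\<^sup>-\<^sup>1 B\<close> cannot be cancelled.\<close>

lemma P2_solution_support:
  assumes nonneg: "fls_subdegree W \<ge> 0"
    and W: "fls_deriv_z (fls_deriv_z W) = 2 * W ^ 3 + fls_X_inv * W + fls_const \<alpha>"
    and "W $$ k \<noteq> 0"
  shows "3 dvd k - 1"
proof (rule ccontr)
  assume k: "\<not> 3 dvd k - 1"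
  define A where "A = Abs_fls (\<lambda>k. if 3 dvd k - 1 then W $$ k else 0)"
  define B where "B = W - A"
  have A: "A $$ k = (if 3 dvd k - 1 then W $$ k else 0)" for k
    unfolding A_def by (rule nth_Abs_fls_lower_bound[of "fls_subdegree W"]) auto
  have B: "B $$ k = (if 3 dvd k - 1 then 0 else W $$ k)" for k
    by (simp add: B_def A)
  have "B $$ k \<noteq> 0" using k \<open>W $$ k \<noteq> 0\<close> by (simp add: B)
  then have "B \<noteq> 0" by auto
  define s where "s = fls_subdegree B"
  have "B $$ s \<noteq> 0" using \<open>B \<noteq> 0\<close> by (simp add: s_def)
  then have s: "\<not> 3 dvd s - 1" "W $$ s \<noteq> 0" by (auto simp: B split: if_splits)
  have "W = A + B" by (simp add: B_def)
  then have cube: "W ^ 3 = A * A * A + B * (3 * (A * A) + 3 * (A * B) + B * B)"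
    by (simp add: power3_eq_cube algebra_simps)
  have "fls_subdegree A \<ge> 0" "fls_subdegree B \<ge> 0"
    using nonneg by (auto simp: fls_subdegree_ge0_iff A B)
  then have "fls_subdegree (3 * (A * A) + 3 * (A * B) + B * B) \<ge> 0"
    by (intro fls_subdegree_mult_ge0 fls_subdegree_add_ge0) auto
  then have "(B * (3 * (A * A) + 3 * (A * B) + B * B)) $$ (s - 1) = 0"
    by (intro fls_times_nth_eq0) (simp add: s_def)
  moreover have "(A * A * A) $$ (s - 1) = 0"
  proof (rule ccontr)
    have 1: "A $$ k \<noteq> 0 \<Longrightarrow> 3 dvd k - 1" for k by (auto simp: A split: if_splits)
    note 2 = fls_mult_support_mod[where q = 3, OF 1 1]
    assume "(A * A * A) $$ (s - 1) \<noteq> 0"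
    from fls_mult_support_mod[where q = 3, OF 2 1 this] have "3 dvd s - 1 - 3" by simp
    with s(1) show False by presburger
  qed
  ultimately have "(W ^ 3) $$ (s - 1) = 0"
    by (simp add: cube)
  \<comment> \<open>Two derivatives shift exponents by 2, so W'' at s - 1 reads W at s - 3. This
    exponent lies in the residue class of s, which belongs to B, and below the first term of
    B.\<close>
  moreover have "W $$ (s - 3) = 0"
  proof -
    have "\<not> 3 dvd s - 3 - 1" using s(1) by presburger
    moreover have "B $$ (s - 3) = 0" by (simp add: s_def)
    ultimately show ?thesis by (simp add: B)
  qed
  then have "fls_deriv_z (fls_deriv_z W) $$ (s - 1) = 0"
    by (simp add: fls_deriv_z_nth)
  moreover have "fls_const \<alpha> $$ (s - 1) = 0" using s(1) by auto
  moreover have "(2 * W ^ 3) $$ (s - 1) = 2 * (W ^ 3) $$ (s - 1)"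
    by (metis fls_const_numeral fls_mult_const_nth(1))
  ultimately show False
    using s(2) unfolding W by (simp add: fls_X_inv_times_conv_shift)
qed

text \<open>Resolves the definite description: \<open>P2_solution_support\<close> supplies the
  exponent pattern, and the vanishing at exponents k \<le> 0 makes l a natural number.\<close>

lemma P2_expansion_eq:
  assumes "\<And>k. k \<le> 0 \<Longrightarrow> W $$ k = 0"
    and W: "fls_deriv_z (fls_deriv_z W) = 2 * W ^ 3 + fls_X_inv * W + fls_const \<alpha>"
  shows "P2_expansion \<alpha> = W"
  unfolding P2_expansion_def
proof (rule the_equality)
  have sub: "fls_subdegree W \<ge> 0"
    using assms(1) by (simp add: fls_subdegree_ge0_iff)
  show "P2_formal_solution \<alpha> W"
    unfolding P2_formal_solution_def
  proof (intro conjI allI impI)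
    fix k assume k: "W $$ k \<noteq> 0"
    then have "k > 0" using assms(1) not_le by blast
    moreover obtain l where "k - 1 = 3 * l"
      using P2_solution_support[OF sub W k] by (elim dvdE)
    ultimately have "k = 3 * int (nat l) + 1" by simp
    then show "\<exists>l::nat. k = 3 * int l + 1" ..
  qed (rule W)
  fix V assume V: "P2_formal_solution \<alpha> V"
  then have "fls_subdegree V \<ge> 0"
    unfolding P2_formal_solution_def fls_subdegree_ge0_iff by force
  with V sub W show "V = W"
    unfolding P2_formal_solution_def by (blast intro: P2_formal_solution_unique)
qed

text \<open>The logarithmic derivative of Q(n)/Q(n+1) starts at t, and \<open>bilinear3\<close>
  turns into its Painleve equation with parameter n + 1, so it is the formal solution.\<close>

lemma P2_coeff_eq_power_sum_diff:
  "P2_coeff (of_nat (Suc n)) (- (int m + 1)) = yv_power_sum n m - yv_power_sum (Suc n) m"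
proof -
  define f g where "f = yv_poly n" and "g = yv_poly (Suc n)"
  have fg: "f \<noteq> 0" "g \<noteq> 0" "bilinear2 f g" "bilinear3 (Suc n) f g"
    using yv_poly_bilinear[of n] by (auto simp: f_def g_def rsquarefree_def)
  have "P2_expansion (of_nat (Suc n)) = log_deriv f - log_deriv g"
  proof (rule P2_expansion_eq)
    show "(log_deriv f - log_deriv g) $$ k = 0" if "k \<le> 0" for k
      using that fg by (simp add: log_deriv_nth)
    show "fls_deriv_z (fls_deriv_z (log_deriv f - log_deriv g)) = 2 * (log_deriv f - log_deriv g) ^ 3
        + fls_X_inv * (log_deriv f - log_deriv g) + fls_const (of_nat (Suc n))"
      using bilinear3_log_deriv[OF fg(1-3)] fg(4) by (simp only: fls_of_nat)
  qed
  then show ?thesis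
    using fg(1,2) by (simp add: P2_coeff_def log_deriv_nth yv_power_sum_def f_def g_def del: of_nat_Suc)
qed

theorem theorem2p1:
  fixes n m :: nat
  assumes "n \<ge> 2" and "m \<ge> 1"
  shows "yv_power_sum n m = - (\<Sum>i=2..n. P2_coeff (of_nat i) (- (int m + 1)))"
  using assms(1)
proof (induction n rule: dec_induct)
  case base
  \<comment> \<open>The only root of Q(1) = z is 0, and 0^m = 0 because m \<ge> 1.\<close>
  have "yv_power_sum 1 m = 0"
    using assms(2) by (simp add: yv_power_sum_def)
  then show ?case
    using P2_coeff_eq_power_sum_diff[of 1 m] by (simp add: numeral_2_eq_2)
next
  case (step n)
  then show ?case
    using P2_coeff_eq_power_sum_diff[of n m] by simp
qed

end
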